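(* Let $A$ and $B$ be operators on a complex Hilbert space $(\mathcal H,\langle\cdot\,;\cdot\rangle)$ such that the pair $(A,B)$ is $(m,P)$-biisometric for some positive integer $m$ and some positive operator $P$ on $\mathcal H$, that is, $$\sum_{j=0}^m(-1)^j\binom{m}{j}A^{*(m-j)}PB^{m-j}=O.$$ If the operator $L_{A^*}R_B$ on $\mathcal B[\mathcal H]$, given by $(L_{A^*}R_B)(X)=A^*XB$ for every $X\in\mathcal B[\mathcal H]$, is power bounded, then the pair $(A,B)$ is $P$-biisometric, that is, $A^*PB=P$.
   Context: An operator on a normed space $\mathcal X$ is a bounded linear map of $\mathcal X$ into itself; $\mathcal B[\mathcal X]$ is the normed algebra of all such operators with the induced uniform norm (so $\mathcal B[\mathcal B[\mathcal H]]$ is the normed algebra of bounded linear maps of $\mathcal B[\mathcal H]$ into itself). $O$ is the null operator. $A^*$ is the Hilbert-space adjoint. An operator $P$ on $\mathcal H$ is positive if it is self-adjoint and $\langle Px\,;x\rangle>0$ for every nonzero $x\in\mathcal H$ (equivalently, nonnegative and injective; it need not be invertible). An operator $T$ on a normed space is power bounded if $\sup_n\|T^n\|<\infty$. For $A,B\in\mathcal B[\mathcal H]$, $L_A(X)=AX$ and $R_B(X)=XB$ for $X\in\mathcal B[\mathcal H]$. *)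

theory Defs
  imports "HOL-Analysis.Analysis"
begin

section \<open>Complex normed spaces and complex Hilbert spaces\<close>

class complex_normed_vector = real_normed_vector +
  fixes scaleC :: "complex \<Rightarrow> 'a \<Rightarrow> 'a" (infixr "*\<^sub>C" 75)
  assumes scaleC_add_right: "a *\<^sub>C (x + y) = a *\<^sub>C x + a *\<^sub>C y"
    and scaleC_add_left: "(a + b) *\<^sub>C x = a *\<^sub>C x + b *\<^sub>C x"
    and scaleC_scaleC: "a *\<^sub>C (b *\<^sub>C x) = (a * b) *\<^sub>C x"
    and scaleR_scaleC: "r *\<^sub>R x = complex_of_real r *\<^sub>C x"
    and norm_scaleC: "norm (a *\<^sub>C x) = cmod a * norm x"

text \<open>The inner product is linear in its first and conjugate-linear in its second argument.\<close>

class complex_inner = complex_normed_vector +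
  fixes cinner :: "'a \<Rightarrow> 'a \<Rightarrow> complex"
  assumes cinner_commute: "cinner x y = cnj (cinner y x)"
    and cinner_add_left: "cinner (x + y) z = cinner x z + cinner y z"
    and cinner_scaleC_left: "cinner (a *\<^sub>C x) y = a * cinner x y"
    and cinner_ge_zero: "0 \<le> Re (cinner x x)"
    and cinner_eq_zero_iff: "cinner x x = 0 \<longleftrightarrow> x = 0"
    and norm_eq_sqrt_cinner: "norm x = sqrt (Re (cinner x x))"

class chilbert_space = complex_inner + complete_space

instantiation complex :: chilbert_space
begin
definition scaleC_complex :: "complex \<Rightarrow> complex \<Rightarrow> complex"
  where "scaleC_complex a x = a * x"
definition cinner_complex :: "complex \<Rightarrow> complex \<Rightarrow> complex"
  where "cinner_complex x y = x * cnj y"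
instance
proof
  fix x y z a b :: complex and r :: real
  show "a *\<^sub>C (x + y) = a *\<^sub>C x + a *\<^sub>C y" "(a + b) *\<^sub>C x = a *\<^sub>C x + b *\<^sub>C x"
    "a *\<^sub>C b *\<^sub>C x = (a * b) *\<^sub>C x" "r *\<^sub>R x = complex_of_real r *\<^sub>C x"
    "norm (a *\<^sub>C x) = cmod a * norm x"
    by (simp_all add: scaleC_complex_def algebra_simps scaleR_conv_of_real norm_mult)
  show "cinner x y = cnj (cinner y x)" "cinner (x + y) z = cinner x z + cinner y z"
    "cinner (a *\<^sub>C x) y = a * cinner x y" "cinner x x = 0 \<longleftrightarrow> x = 0"
    "0 \<le> Re (cinner x x)" "norm x = sqrt (Re (cinner x x))"
    by (simp_all add: cinner_complex_def scaleC_complex_def algebra_simps cmod_def power2_eq_square)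
qed
end

lemma scaleC_zero_right [simp]: "a *\<^sub>C (0::'a::complex_normed_vector) = 0"
  using scaleC_add_right[of a 0 "0::'a"] by simp

lemma scaleC_zero_left [simp]: "0 *\<^sub>C (x::'a::complex_normed_vector) = 0"
  using scaleR_scaleC[of 0 x] by simp

lemma scaleC_one [simp]: "1 *\<^sub>C (x::'a::complex_normed_vector) = x"
  using scaleR_scaleC[of 1 x] by simp

lemma scaleC_scaleR: "a *\<^sub>C (r *\<^sub>R x) = r *\<^sub>R (a *\<^sub>C (x::'a::complex_normed_vector))"
  by (simp add: scaleR_scaleC scaleC_scaleC mult.commute)

lemma scaleC_minus_right: "a *\<^sub>C (- x) = - (a *\<^sub>C (x::'a::complex_normed_vector))"
  using scaleC_add_right[of a x "- x"] by (simp add: eq_neg_iff_add_eq_0 add.commute)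

lemma scaleC_diff_right: "a *\<^sub>C (x - y) = a *\<^sub>C x - a *\<^sub>C (y::'a::complex_normed_vector)"
  using scaleC_add_right[of a x "- y"] by (simp add: scaleC_minus_right)

lemma bounded_linear_scaleC: "bounded_linear (\<lambda>x::'a::complex_normed_vector. a *\<^sub>C x)"
  by (rule bounded_linear_intro[where K = "cmod a"])
     (auto simp: scaleC_add_right scaleC_scaleR norm_scaleC)


section \<open>The normed algebra of operators on a complex normed space\<close>

typedef (overloaded) ('a::complex_normed_vector) operator =
    "{f :: 'a \<Rightarrow> 'a. bounded_linear f \<and> (\<forall>c x. f (c *\<^sub>C x) = c *\<^sub>C f x)}"
  morphisms app Operator
  by (rule exI[of _ "\<lambda>_. 0"]) simp

setup_lifting type_definition_operator

lemma bounded_linear_app: "bounded_linear (app A)"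
  and app_scaleC: "app A (c *\<^sub>C x) = c *\<^sub>C app A x"
  using app[of A] by auto

lemma operator_eqI: "(\<And>x. app A x = app B x) \<Longrightarrow> A = B"
  by transfer auto

lemma onorm_scaleC_le:
  assumes "bounded_linear (f :: 'a::complex_normed_vector \<Rightarrow> 'a)"
  shows "onorm (\<lambda>x. c *\<^sub>C f x) \<le> cmod c * onorm f"
  by (rule onorm_bound)
     (auto simp: norm_scaleC onorm_pos_le[OF assms] mult.assoc onorm[OF assms] intro!: mult_left_mono)

lemma onorm_scaleC:
  assumes f: "bounded_linear (f :: 'a::complex_normed_vector \<Rightarrow> 'a)"
  shows "onorm (\<lambda>x. c *\<^sub>C f x) = cmod c * onorm f"
proof (cases "c = 0")
  case True
  then show ?thesis by (simp add: onorm_zero)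
next
  case False
  have g: "bounded_linear (\<lambda>x. c *\<^sub>C f x)"
    by (rule bounded_linear_compose[OF bounded_linear_scaleC f])
  have "onorm f = onorm (\<lambda>x. inverse c *\<^sub>C (c *\<^sub>C f x))"
    using False by (simp add: scaleC_scaleC)
  also have "\<dots> \<le> inverse (cmod c) * onorm (\<lambda>x. c *\<^sub>C f x)"
    using onorm_scaleC_le[OF g, of "inverse c"] by (simp add: norm_inverse)
  finally have "cmod c * onorm f \<le> onorm (\<lambda>x. c *\<^sub>C f x)"
    using False by (simp add: field_simps)
  then show ?thesis
    using onorm_scaleC_le[OF f, of c] by simp
qed

instantiation operator :: (complex_normed_vector) complex_normed_vector
begin

lift_definition norm_operator :: "'a operator \<Rightarrow> real" is onorm .

lift_definition zero_operator :: "'a operator" is "\<lambda>_. 0" by simp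

lift_definition plus_operator :: "'a operator \<Rightarrow> 'a operator \<Rightarrow> 'a operator"
  is "\<lambda>f g x. f x + g x" by (simp add: bounded_linear_add scaleC_add_right)

lift_definition uminus_operator :: "'a operator \<Rightarrow> 'a operator"
  is "\<lambda>f x. - f x" by (simp add: bounded_linear_minus scaleC_minus_right)

lift_definition minus_operator :: "'a operator \<Rightarrow> 'a operator \<Rightarrow> 'a operator"
  is "\<lambda>f g x. f x - g x" by (simp add: bounded_linear_sub scaleC_diff_right)

lift_definition scaleC_operator :: "complex \<Rightarrow> 'a operator \<Rightarrow> 'a operator"
  is "\<lambda>c f x. c *\<^sub>C f x"
  by (simp add: bounded_linear_compose[OF bounded_linear_scaleC] scaleC_scaleC mult.commute)

lift_definition scaleR_operator :: "real \<Rightarrow> 'a operator \<Rightarrow> 'a operator"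
  is "\<lambda>r f x. r *\<^sub>R f x"
  by (simp add: bounded_linear_const_scaleR scaleC_scaleR)

definition sgn_operator :: "'a operator \<Rightarrow> 'a operator"
  where "sgn_operator A = inverse (norm A) *\<^sub>R A"

definition dist_operator :: "'a operator \<Rightarrow> 'a operator \<Rightarrow> real"
  where "dist_operator A B = norm (A - B)"

definition uniformity_operator :: "('a operator \<times> 'a operator) filter"
  where "uniformity_operator = (INF e\<in>{0<..}. principal {(x, y). dist x y < e})"

definition open_operator :: "'a operator set \<Rightarrow> bool"
  where "open_operator S = (\<forall>x\<in>S. \<forall>\<^sub>F (x', y) in uniformity. x' = x \<longrightarrow> y \<in> S)"

instance
proof
  fix A B C :: "'a operator" and a b :: complex and r s :: real and S :: "'a operator set"
  show "A + B + C = A + (B + C)" "A + B = B + A" "0 + A = A" "- A + A = 0" "A - B = A + - B"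
    by (transfer; simp add: algebra_simps)+
  show "r *\<^sub>R (A + B) = r *\<^sub>R A + r *\<^sub>R B" "(r + s) *\<^sub>R A = r *\<^sub>R A + s *\<^sub>R A"
    "r *\<^sub>R s *\<^sub>R A = (r * s) *\<^sub>R A" "1 *\<^sub>R A = A"
    by (transfer; simp add: algebra_simps)+
  show "a *\<^sub>C (A + B) = a *\<^sub>C A + a *\<^sub>C B" "(a + b) *\<^sub>C A = a *\<^sub>C A + b *\<^sub>C A"
    "a *\<^sub>C b *\<^sub>C A = (a * b) *\<^sub>C A" "r *\<^sub>R A = complex_of_real r *\<^sub>C A"
    by (transfer; simp add: scaleC_add_right scaleC_add_left scaleC_scaleC scaleR_scaleC)+
  show "norm (a *\<^sub>C A) = cmod a * norm A"
    by transfer (simp add: onorm_scaleC)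
  show "norm (r *\<^sub>R A) = \<bar>r\<bar> * norm A"
    by transfer (simp add: onorm_scaleR)
  show "norm A = 0 \<longleftrightarrow> A = 0"
    by transfer (auto simp: onorm_eq_0 fun_eq_iff)
  show "norm (A + B) \<le> norm A + norm B"
    by transfer (simp add: onorm_triangle)
  show "sgn A = inverse (norm A) *\<^sub>R A" "dist A B = norm (A - B)"
    by (simp_all add: sgn_operator_def dist_operator_def)
  show "(uniformity :: ('a operator \<times> 'a operator) filter) =
      (INF e\<in>{0<..}. principal {(x, y). dist x y < e})"
    by (rule uniformity_operator_def)
  show "open S \<longleftrightarrow> (\<forall>x\<in>S. \<forall>\<^sub>F (x', y) in uniformity. x' = x \<longrightarrow> y \<in> S)"
    by (rule open_operator_def)
qed

end

text \<open>Multiplication of operators is composition; \<open>A ^ n\<close> is the \<open>n\<close>-fold composition.\<close>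

instantiation operator :: (complex_normed_vector) "{real_normed_algebra, monoid_mult}"
begin

lift_definition one_operator :: "'a operator" is "\<lambda>x. x" by simp

lift_definition times_operator :: "'a operator \<Rightarrow> 'a operator \<Rightarrow> 'a operator"
  is "\<lambda>f g x. f (g x)" by (simp add: bounded_linear_compose)

instance
proof
  fix A B C :: "'a operator" and r :: real
  show "A * B * C = A * (B * C)" "1 * A = A" "A * 1 = A" "(A + B) * C = A * C + B * C"
    by (transfer; simp)+
  show "A * (B + C) = A * B + A * C" "r *\<^sub>R A * B = r *\<^sub>R (A * B)" "A * r *\<^sub>R B = r *\<^sub>R (A * B)"
    by (transfer; auto simp: fun_eq_iff linear_add linear_scale dest!: bounded_linear.linear)+
  show "norm (A * B) \<le> norm A * norm B"
    by transfer (use onorm_compose in \<open>auto simp: o_def\<close>)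
qed

end

definition power_bounded :: "'a::complex_normed_vector operator \<Rightarrow> bool"
  where "power_bounded T \<longleftrightarrow> bdd_above (range (\<lambda>n. norm (T ^ n)))"

lemma app_Operator:
  "bounded_linear f \<Longrightarrow> (\<And>c x. f (c *\<^sub>C x) = c *\<^sub>C f x) \<Longrightarrow> app (Operator f) = f"
  by (simp add: Operator_inverse)

definition left_mult :: "'a::complex_normed_vector operator \<Rightarrow> 'a operator operator"
  where "left_mult A = Operator (\<lambda>X. A * X)"

definition right_mult :: "'a::complex_normed_vector operator \<Rightarrow> 'a operator operator"
  where "right_mult B = Operator (\<lambda>X. X * B)"

lemma app_left_mult [simp]: "app (left_mult A) X = A * X"
proof -
  have "A * (c *\<^sub>C X) = c *\<^sub>C (A * X)" for c X by transfer simp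
  then show ?thesis by (simp add: left_mult_def app_Operator bounded_linear_mult_right)
qed

lemma app_right_mult [simp]: "app (right_mult B) X = X * B"
proof -
  have "c *\<^sub>C X * B = c *\<^sub>C (X * B)" for c X by transfer simp
  then show ?thesis by (simp add: right_mult_def app_Operator bounded_linear_mult_left)
qed


section \<open>Adjoints\<close>

definition adj :: "'a::chilbert_space operator \<Rightarrow> 'a operator"
  where "adj A = (THE B. \<forall>x y. cinner (app A x) y = cinner x (app B y))"

lemma cinner_add_right: "cinner x (y + z) = cinner x y + cinner x (z::'a::complex_inner)"
  by (metis cinner_add_left cinner_commute complex_cnj_add)

lemma cinner_scaleC_right: "cinner x (a *\<^sub>C y) = cnj a * cinner x (y::'a::complex_inner)"
  by (metis cinner_commute cinner_scaleC_left complex_cnj_mult)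

lemma cinner_scaleR_left: "cinner (r *\<^sub>R x) y = of_real r * cinner x (y::'a::complex_inner)"
  by (simp add: scaleR_scaleC cinner_scaleC_left)

lemma cinner_scaleR_right: "cinner x (r *\<^sub>R y) = of_real r * cinner x (y::'a::complex_inner)"
  by (simp add: scaleR_scaleC cinner_scaleC_right)

lemma cinner_diff_left: "cinner (x - y) z = cinner x z - cinner y (z::'a::complex_inner)"
  using cinner_add_left[of "x - y" y z] by simp

lemma cinner_diff_right: "cinner x (y - z) = cinner x y - cinner x (z::'a::complex_inner)"
  using cinner_add_right[of x "y - z" z] by simp

lemma Re_cinner_self: "Re (cinner x x) = (norm x)\<^sup>2" for x :: "'a::complex_inner"
  by (simp add: norm_eq_sqrt_cinner cinner_ge_zero)

lemma cinner_self: "cinner x x = of_real ((norm x)\<^sup>2)" for x :: "'a::complex_inner"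
proof -
  have "Im (cinner x x) = 0"
    using arg_cong[OF cinner_commute[of x x], of Im] by simp
  then show ?thesis by (simp add: complex_eq_iff Re_cinner_self)
qed

lemma Re_cinner_commute: "Re (cinner x y) = Re (cinner y (x::'a::complex_inner))"
  by (subst cinner_commute) simp

lemma cinner_right_eqI: "(\<And>x. cinner x y = cinner x z) \<Longrightarrow> y = (z::'a::complex_inner)"
  using cinner_eq_zero_iff[of "y - z"] by (simp add: cinner_diff_right)

lemma norm_add_square:
  "(norm (x + y))\<^sup>2 = (norm x)\<^sup>2 + 2 * Re (cinner x y) + (norm (y::'a::complex_inner))\<^sup>2"
  using Re_cinner_commute[of x y]
  by (simp flip: Re_cinner_self add: cinner_add_left cinner_add_right)

lemma parallelogram_law:
  "(norm (x + y))\<^sup>2 + (norm (x - y))\<^sup>2 = 2 * (norm x)\<^sup>2 + 2 * (norm (y::'a::complex_inner))\<^sup>2"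
  using Re_cinner_commute[of x y]
  by (simp flip: Re_cinner_self add: cinner_add_left cinner_add_right cinner_diff_left cinner_diff_right)

lemma nonneg_quadratic_imp:
  fixes a b :: real
  assumes "\<And>t. 0 \<le> a + 2 * t * b + t\<^sup>2 * c" and "0 \<le> c"
  shows "b\<^sup>2 \<le> a * c"
proof (cases "c = 0")
  case True
  have "b = 0"
  proof (rule ccontr)
    assume "b \<noteq> 0"
    then show False
      using assms(1)[of "- (a + 1) / (2 * b)"] True by (simp add: field_simps)
  qed
  then show ?thesis using True by simp
next
  case False
  then show ?thesis
    using assms(1)[of "- b / c"] assms(2) by (simp add: field_simps power2_eq_square)
qed

lemma cinner_Cauchy_Schwarz: "cmod (cinner x y) \<le> norm x * norm (y::'a::complex_inner)"
proof (cases "cinner x y = 0")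
  case False
  define u where "u = cnj (cinner x y) / cmod (cinner x y)"
  have u: "cmod u = 1"
    using False by (simp add: u_def norm_divide)
  have "cinner (u *\<^sub>C x) y = cinner x y * cnj (cinner x y) / cmod (cinner x y)"
    by (simp add: u_def cinner_scaleC_left mult.commute)
  then have ux: "cinner (u *\<^sub>C x) y = cmod (cinner x y)"
    using False by (simp flip: complex_norm_square add: power2_eq_square)
  have "(cmod (cinner x y))\<^sup>2 \<le> (norm (u *\<^sub>C x))\<^sup>2 * (norm y)\<^sup>2"
  proof (rule nonneg_quadratic_imp)
    fix t :: real
    have "0 \<le> (norm (u *\<^sub>C x + t *\<^sub>R y))\<^sup>2" by simp
    then show "0 \<le> (norm (u *\<^sub>C x))\<^sup>2 + 2 * t * cmod (cinner x y) + t\<^sup>2 * (norm y)\<^sup>2"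
      by (simp add: norm_add_square cinner_scaleR_right ux power_mult_distrib)
  qed simp
  then have "(cmod (cinner x y))\<^sup>2 \<le> (norm x * norm y)\<^sup>2"
    by (simp add: norm_scaleC u power_mult_distrib)
  then show ?thesis by (rule power2_le_imp_le) simp
qed simp

lemma Riesz_representation:
  fixes f :: "'a::chilbert_space \<Rightarrow> complex"
  assumes f: "bounded_linear f" and fC: "\<And>c x. f (c *\<^sub>C x) = c * f x"
  shows "\<exists>z. \<forall>x. f x = cinner x z"
proof -
  interpret f: bounded_linear f by fact
  define J where "J x = (norm x)\<^sup>2 - 2 * Re (f x)" for x
  have cont: "continuous_on UNIV J"
    unfolding J_def by (intro continuous_intros f.continuous_on)
  have bdd: "- (onorm f)\<^sup>2 \<le> J x" for x
  proof -
    have "Re (f x) \<le> onorm f * norm x"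
      using onorm[OF f, of x] complex_Re_le_cmod[of "f x"] by linarith
    moreover have "0 \<le> (norm x - onorm f)\<^sup>2" by simp
    ultimately show ?thesis by (simp add: J_def power2_diff algebra_simps)
  qed
  define d where "d = Inf (range J)"
  have bb: "bdd_below (range J)" using bdd by (auto simp: bdd_below_def)
  have d_le: "d \<le> J x" for x
    unfolding d_def by (rule cInf_lower[OF _ bb]) simp
  have "\<exists>x. J x < d + inverse (real (Suc n))" for n
    using cInf_lessD[of "range J" "d + inverse (real (Suc n))"] by (auto simp: d_def)
  then obtain s where s: "\<And>n. J (s n) < d + inverse (real (Suc n))" by metis
  have para: "(norm (x - y))\<^sup>2 \<le> 2 * (J x - d) + 2 * (J y - d)" for x y
  proof -
    have "J ((1/2) *\<^sub>R v) = (norm v)\<^sup>2 / 4 - Re (f v)" for v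
      by (simp add: J_def f.scaleR power_divide)
    from this[of "x + y"] show ?thesis
      using d_le[of "(1/2) *\<^sub>R (x + y)"] parallelogram_law[of x y] by (simp only: J_def f.add) simp
  qed
  have "Cauchy s"
  proof (rule metric_CauchyI)
    fix e :: real assume "0 < e"
    then obtain N where N: "inverse (real (Suc N)) < e\<^sup>2 / 4"
      using reals_Archimedean[of "e\<^sup>2 / 4"] by auto
    have small: "J (s n) - d < e\<^sup>2 / 4" if "N \<le> n" for n
    proof -
      have "inverse (real (Suc n)) \<le> inverse (real (Suc N))" using that by simp
      then show ?thesis using s[of n] N by linarith
    qed
    have "dist (s m) (s n) < e" if "N \<le> m" "N \<le> n" for m n
    proof -
      have "(norm (s m - s n))\<^sup>2 < e\<^sup>2"
        using para[of "s m" "s n"] small[OF that(1)] small[OF that(2)] by argo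
      then show ?thesis
        using \<open>0 < e\<close> by (simp add: dist_norm power_less_imp_less_base)
    qed
    then show "\<exists>N. \<forall>m\<ge>N. \<forall>n\<ge>N. dist (s m) (s n) < e" by blast
  qed
  then obtain z where z: "s \<longlonglongrightarrow> z"
    using Cauchy_convergent convergent_def by blast
  have "(\<lambda>n. J (s n)) \<longlonglongrightarrow> J z"
    using continuous_on_tendsto_compose[OF cont z] by simp
  moreover have "(\<lambda>n. d + inverse (real (Suc n))) \<longlonglongrightarrow> d + 0"
    by (intro tendsto_intros LIMSEQ_inverse_real_of_nat)
  ultimately have "J z \<le> d + 0"
    by (rule LIMSEQ_le) (use s less_imp_le in blast)
  then have Jz: "J z \<le> d" by simp
  have Re_eq: "Re (f x) = Re (cinner x z)" for x
  proof -
    have "0 \<le> 0 + 2 * t * (Re (cinner x z) - Re (f x)) + t\<^sup>2 * (norm x)\<^sup>2" for t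
      using d_le[of "z + t *\<^sub>R x"] Jz Re_cinner_commute[of x z]
      by (simp add: J_def norm_add_square cinner_scaleR_right f.add f.scaleR
          power_mult_distrib algebra_simps)
    then have "(Re (cinner x z) - Re (f x))\<^sup>2 \<le> 0 * (norm x)\<^sup>2"
      by (rule nonneg_quadratic_imp) simp
    then show ?thesis by simp
  qed
  have "f x = cinner x z" for x
    using Re_eq[of x] Re_eq[of "\<i> *\<^sub>C x"] by (simp add: fC cinner_scaleC_left complex_eq_iff)
  then show ?thesis by blast
qed

lemma adj_exists_unique: "\<exists>!B. \<forall>x y. cinner (app A x) y = cinner x (app B y)"
  for A :: "'a::chilbert_space operator"
proof -
  interpret A: bounded_linear "app A" by (rule bounded_linear_app)
  have "\<exists>z. \<forall>x. cinner (app A x) y = cinner x z" for y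
  proof (rule Riesz_representation)
    show "bounded_linear (\<lambda>x. cinner (app A x) y)"
    proof (rule bounded_linear_intro)
      show "norm (cinner (app A x) y) \<le> norm x * (onorm (app A) * norm y)" for x
        using cinner_Cauchy_Schwarz[of "app A x" y] onorm[OF bounded_linear_app, of A x]
          mult_right_mono[OF onorm[OF bounded_linear_app, of A x] norm_ge_zero[of y]]
        by (simp add: algebra_simps)
    qed (auto simp: A.add A.scaleR cinner_add_left cinner_scaleR_left scaleR_conv_of_real)
  qed (simp add: app_scaleC cinner_scaleC_left)
  then obtain g where g: "\<And>x y. cinner (app A x) y = cinner x (g y)" by metis
  have g_add: "g (x + y) = g x + g y" for x y
    by (rule cinner_right_eqI) (simp flip: g add: cinner_add_right)
  have g_scaleC: "g (c *\<^sub>C x) = c *\<^sub>C g x" for c x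
    by (rule cinner_right_eqI) (simp flip: g add: cinner_scaleC_right)
  have g_norm: "norm (g y) \<le> norm y * onorm (app A)" for y
  proof (cases "g y = 0")
    case True
    then show ?thesis by (simp add: onorm_pos_le bounded_linear_app)
  next
    case False
    have "(norm (g y))\<^sup>2 = cmod (cinner (app A (g y)) y)"
      by (simp add: g cinner_self norm_power)
    also have "\<dots> \<le> norm (app A (g y)) * norm y" by (rule cinner_Cauchy_Schwarz)
    also have "\<dots> \<le> (onorm (app A) * norm (g y)) * norm y"
      by (intro mult_right_mono onorm bounded_linear_app norm_ge_zero)
    finally show ?thesis using False by (simp add: power2_eq_square mult_ac)
  qed
  have "bounded_linear g"
    by (rule bounded_linear_intro[OF g_add _ g_norm]) (simp add: scaleR_scaleC g_scaleC)
  then have "\<forall>x y. cinner (app A x) y = cinner x (app (Operator g) y)"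
    by (simp add: app_Operator g_scaleC g)
  moreover have "B = C" if "\<forall>x y. cinner (app A x) y = cinner x (app B y)"
    "\<forall>x y. cinner (app A x) y = cinner x (app C y)" for B C
    by (rule operator_eqI, rule cinner_right_eqI) (simp flip: that[rule_format])
  ultimately show ?thesis by (rule ex_ex1I[OF exI])
qed

lemma cinner_adj: "cinner (app A x) y = cinner x (app (adj A) y)"
  using theI'[OF adj_exists_unique[of A]] unfolding adj_def by blast


section \<open>Positive operators and biisometric pairs\<close>

text \<open>For self-adjoint \<open>P\<close> the number \<open>cinner (app P x) x\<close> is real. Positivity here is strict on
  nonzero vectors, so \<open>P\<close> is injective, but \<open>P\<close> need not be invertible.\<close>

definition positive_op :: "'a::chilbert_space operator \<Rightarrow> bool"
  where "positive_op P \<longleftrightarrow> adj P = P \<and> (\<forall>x. x \<noteq> 0 \<longrightarrow> 0 < Re (cinner (app P x) x))"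

definition biisometric ::
    "nat \<Rightarrow> 'a::chilbert_space operator \<Rightarrow> 'a operator \<Rightarrow> 'a operator \<Rightarrow> bool"
  where "biisometric m P A B \<longleftrightarrow>
    (\<Sum>j=0..m. ((-1) ^ j * of_nat (m choose j)) *\<^sub>C (adj A ^ (m - j) * P * B ^ (m - j))) = 0"

end

theory Submission
  imports Defs
begin

text \<open>With \<open>T = left_mult (adj A) * right_mult B\<close>, the hypothesis says \<open>(T - 1) ^ m\<close> kills \<open>P\<close>. If
  \<open>(T - 1)\<^sup>2\<close> kills \<open>Y\<close>, then \<open>T ^ n\<close> maps \<open>Y\<close> to \<open>Y\<close> plus \<open>n\<close> times the image of \<open>Y\<close> under
  \<open>T - 1\<close>, so power boundedness forces \<open>T\<close> to fix \<open>Y\<close>. Hence the kernels of the powers of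
  \<open>T - 1\<close> all coincide, and \<open>T\<close> fixes \<open>P\<close>.\<close>

lemma app_1 [simp]: "app 1 x = x"
  by transfer simp

lemma app_times [simp]: "app (S * T) x = app S (app T x)"
  by transfer simp

lemma app_minus [simp]: "app (S - T) x = app S x - app T x"
  by transfer simp

lemma app_diff: "app T (x - y) = app T x - app T y"
  by (simp add: bounded_linear_app linear_diff bounded_linear.linear)

lemma app_add: "app T (x + y) = app T x + app T y"
  by (simp add: bounded_linear_app linear_add bounded_linear.linear)

lemma app_scaleR: "app T (r *\<^sub>R x) = r *\<^sub>R app T x"
  by (simp add: bounded_linear_app linear_scale bounded_linear.linear)

lemma norm_app_le: "norm (app T x) \<le> norm T * norm x"
  by transfer (simp add: onorm)

text \<open>Pascal's rule gives the induction step. It makes the sum in \<open>biisometric\<close>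
  the value of a power of \<open>T - 1\<close>.\<close>

lemma app_binomial:
  "app ((T - 1) ^ m) x = (\<Sum>j\<le>m. ((-1) ^ j * real (m choose j)) *\<^sub>R app (T ^ (m - j)) x)"
proof (induction m arbitrary: x)
  case (Suc m)
  define c where "c j = (-1) ^ j * real (m choose j)" for j
  have pascal: "c (Suc j) - c j = (-1) ^ Suc j * real (Suc m choose Suc j)" for j
    by (simp add: c_def algebra_simps)
  \<comment> \<open>The factor is peeled off on the right, so the induction hypothesis is used at
    both \<open>app T x\<close> and \<open>x\<close>.\<close>
  have "app ((T - 1) ^ Suc m) x = app ((T - 1) ^ m) (app T x) - app ((T - 1) ^ m) x"
    by (simp add: power_Suc2 app_diff del: power_Suc)
  also have "\<dots> = (\<Sum>j\<le>m. c j *\<^sub>R app (T ^ (Suc m - j)) x) - (\<Sum>j\<le>m. c j *\<^sub>R app (T ^ (m - j)) x)"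
    by (simp add: Suc.IH c_def Suc_diff_le power_Suc2 del: power_Suc)
  \<comment> \<open>The added term vanishes, as \<open>m choose Suc m\<close> is 0; the longer range
    allows the index shift that follows.\<close>
  also have "(\<Sum>j\<le>m. c j *\<^sub>R app (T ^ (Suc m - j)) x) = (\<Sum>j\<le>Suc m. c j *\<^sub>R app (T ^ (Suc m - j)) x)"
    by (simp add: c_def)
  also have "\<dots> = app (T ^ Suc m) x + (\<Sum>j\<le>m. c (Suc j) *\<^sub>R app (T ^ (m - j)) x)"
    by (subst sum.atMost_Suc_shift) (simp add: c_def)
  also have "app (T ^ Suc m) x + (\<Sum>j\<le>m. c (Suc j) *\<^sub>R app (T ^ (m - j)) x)
      - (\<Sum>j\<le>m. c j *\<^sub>R app (T ^ (m - j)) x)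
    = app (T ^ Suc m) x + (\<Sum>j\<le>m. (c (Suc j) - c j) *\<^sub>R app (T ^ (m - j)) x)"
    by (simp add: scaleR_diff_left sum_subtractf)
  also have "\<dots> = (\<Sum>j\<le>Suc m. ((-1) ^ j * real (Suc m choose j)) *\<^sub>R app (T ^ (Suc m - j)) x)"
    unfolding pascal by (subst sum.atMost_Suc_shift) simp
  finally show ?case .
qed simp

lemma power_bounded_fixes_of_square:
  assumes "power_bounded T" and kernel: "app (T - 1) (app (T - 1) y) = 0"
  shows "app (T - 1) y = 0"
proof (rule ccontr)
  define d where "d = app (T - 1) y"
  assume "app (T - 1) y \<noteq> 0"
  then have d: "norm d > 0" by (simp add: d_def)
  have Td: "app T d = d" and Ty: "app T y = y + d"
    using kernel by (simp_all add: d_def)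
  \<comment> \<open>As \<open>T\<close> fixes \<open>d\<close>, each application of \<open>T\<close>
    adds one more \<open>d\<close>.\<close>
  have growth: "app (T ^ n) y = y + real n *\<^sub>R d" for n
    by (induction n) (simp_all add: app_add app_scaleR Td Ty algebra_simps)
  obtain M where M: "\<And>n. norm (T ^ n) \<le> M"
    using assms(1) by (auto simp: power_bounded_def bdd_above_def)
  have "real n * norm d \<le> M * norm y + norm y" for n
  proof -
    have "real n * norm d = norm (app (T ^ n) y - y)" by (simp add: growth)
    also have "\<dots> \<le> norm (app (T ^ n) y) + norm y" by (rule norm_triangle_ineq4)
    also have "norm (app (T ^ n) y) \<le> M * norm y"
      using norm_app_le mult_right_mono[OF M norm_ge_zero] order_trans by blast
    finally show ?thesis by simp
  qed
  moreover obtain n where "M * norm y + norm y < real n * norm d"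
    using ex_less_of_nat_mult[OF d] by blast
  ultimately show False by (meson not_less)
qed

text \<open>Each induction step cancels one factor \<open>T - 1\<close>, down to exponent 1.\<close>

lemma power_bounded_fixes:
  assumes "power_bounded T" and "app ((T - 1) ^ Suc k) x = 0"
  shows "app T x = x"
  using assms(2)
proof (induction k)
  case (Suc k)
  then show ?case
    using power_bounded_fixes_of_square[OF assms(1), of "app ((T - 1) ^ k) x"] by simp
qed simp

text \<open>By associativity, left and right multiplications commute.\<close>

lemma app_mult_power: "app ((left_mult A * right_mult B) ^ n) X = A ^ n * X * B ^ n"
proof (induction n)
  case (Suc n)
  then show ?case
    \<comment> \<open>The new factor \<open>B\<close> must come out on the right, so its power is
      split first.\<close>
    by (simp add: power_Suc2[of B] mult.assoc del: power_Suc) (simp add: mult.assoc)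
qed simp

theorem theorem4p1:
  fixes A B P :: "'a::chilbert_space operator" and m :: nat
  assumes "0 < m"
    and "positive_op P"
    and "biisometric m P A B"
    and "power_bounded (left_mult (adj A) * right_mult B)"
  shows "adj A * P * B = P"
proof -
  let ?T = "left_mult (adj A) * right_mult B"
  obtain k where k: "m = Suc k" using assms(1) by (cases m) auto
  have "app ((?T - 1) ^ m) P = 0"
    using assms(3) unfolding app_binomial app_mult_power biisometric_def
    \<comment> \<open>The real coefficients of \<open>app_binomial\<close> become the complex ones
      of \<open>biisometric\<close>.\<close>
    by (simp add: scaleR_scaleC atMost_atLeast0)
  then have "app ?T P = P"
    using power_bounded_fixes[OF assms(4)] unfolding k by blast
  then show ?thesis by (simp add: mult.assoc)
qed

end
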